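(* Let $k\ge1$ be an integer. The helicoid $H_k\subset\mathbb{R}^{2k+1}$ is an entire graph over a $(k+1)$-plane if and only if $k$ is even.
   Context: $H_k$ is the image of $F:\mathbb{R}^k\times\mathbb{R}\to\mathbb{R}^k\times\mathbb{R}^k\times\mathbb{R}=\mathbb{R}^{2k+1}$, $F(u,s)=(\cos s\,u,\sin s\,u,s)$. $H_k$ is an entire graph over a $(k+1)$-plane if there is a $(k+1)$-dimensional linear subspace $\Pi\subset\mathbb{R}^{2k+1}$ such that, with $P_\Pi$ the orthogonal projection onto $\Pi$, the map $P_\Pi\circ F:\mathbb{R}^k\times\mathbb{R}\to\Pi$ is a global diffeomorphism. *)

theory Defs
  imports "HOL-Analysis.Analysis"
begin

text \<open>Order-n continuous differentiability, meant for an open set U. The directional derivative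
  of f along any fixed v is again a map with values in the same space, which makes the
  recursion well typed.\<close>

primrec Cn_on :: "nat \<Rightarrow> ('a::real_normed_vector \<Rightarrow> 'b::real_normed_vector) \<Rightarrow> 'a set \<Rightarrow> bool" where
  "Cn_on 0 f U \<longleftrightarrow> continuous_on U f"
| "Cn_on (Suc n) f U \<longleftrightarrow>
     (\<forall>x\<in>U. f differentiable (at x)) \<and>
     (\<forall>v. Cn_on n (\<lambda>x. frechet_derivative f (at x) v) U)"

text \<open>Smoothness on an arbitrary subset A of the domain, which need not be open (such as a proper
  linear subspace): near each point of A, f agrees on A with a smooth map
  defined on an open set of the ambient space.\<close>

definition smooth_map_on :: "'a::euclidean_space set \<Rightarrow> ('a \<Rightarrow> 'b::euclidean_space) \<Rightarrow> bool" where
  "smooth_map_on A f \<longleftrightarrow>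
     (\<forall>x\<in>A. \<exists>U g. open U \<and> x \<in> U \<and> (\<forall>n. Cn_on n g U) \<and> (\<forall>y\<in>A \<inter> U. g y = f y))"

definition diffeomorphism_between ::
    "'a::euclidean_space set \<Rightarrow> 'b::euclidean_space set \<Rightarrow> ('a \<Rightarrow> 'b) \<Rightarrow> bool" where
  "diffeomorphism_between A B f \<longleftrightarrow>
     bij_betw f A B \<and> smooth_map_on A f \<and> smooth_map_on B (inv_into A f)"

definition orth_proj :: "'a::euclidean_space set \<Rightarrow> 'a \<Rightarrow> 'a" where
  "orth_proj P x = (THE y. y \<in> P \<and> (\<forall>z\<in>P. orthogonal (x - y) z))"

lemma orth_proj_ex1:
  fixes P :: "'a::euclidean_space set"
  assumes "subspace P"
  shows "\<exists>!y. y \<in> P \<and> (\<forall>z\<in>P. orthogonal (x - y) z)"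
proof -
  obtain y w where yw: "y \<in> span P" "\<And>z. z \<in> span P \<Longrightarrow> orthogonal w z" "x = y + w"
    using orthogonal_subspace_decomp_exists by blast
  have sp: "span P = P"
    using assms by (simp add: span_eq_iff)
  show ?thesis
  proof (rule ex1I[of _ y])
    show "y \<in> P \<and> (\<forall>z\<in>P. orthogonal (x - y) z)"
      using yw sp by auto
    fix y' assume y': "y' \<in> P \<and> (\<forall>z\<in>P. orthogonal (x - y') z)"
    have d: "y' - y \<in> P"
      using y' yw(1) sp assms by (simp add: subspace_diff)
    have "(x - y) \<bullet> (y' - y) = 0" "(x - y') \<bullet> (y' - y) = 0"
      using d yw sp y' by (auto simp: orthogonal_def)
    then have "(y' - y) \<bullet> (y' - y) = 0"
      by (simp add: inner_diff_left)
    then show "y' = y" by simp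
  qed
qed

definition helicoid_param :: "(real^'k) \<times> real \<Rightarrow> (real^'k) \<times> (real^'k) \<times> real" where
  "helicoid_param = (\<lambda>(u, s). (cos s *\<^sub>R u, sin s *\<^sub>R u, s))"

text \<open>The image of F is an entire graph over some m-dimensional linear subspace, in the sense
  attached to the parametrization F.\<close>

definition entire_graph_over_plane ::
    "('a::euclidean_space \<Rightarrow> 'b::euclidean_space) \<Rightarrow> nat \<Rightarrow> bool" where
  "entire_graph_over_plane F m \<longleftrightarrow>
     (\<exists>P. subspace P \<and> dim P = m \<and> diffeomorphism_between UNIV P (orth_proj P \<circ> F))"

end

theory Submission
  imports Defs
begin

text \<open>Write \<open>P\<close> for the projection, \<open>A u = P(u,0,0)\<close>, \<open>B u = P(0,u,0)\<close>, \<open>c = P(0,0,1)\<close>, so that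
  \<open>P (F(u,s)) = cos s A u + sin s B u + s c\<close>. Injectivity makes every \<open>cos s A + sin s B\<close> injective.
  If some \<open>B u\<close> lay outside \<open>range A\<close>, a hyperplane of the target plane, a suitable multiple of \<open>u\<close>
  would give a critical point at \<open>s = 0\<close>; hence \<open>B = A T\<close> for an endomorphism \<open>T\<close>, and
  \<open>det (cos s + sin s T)\<close> never vanishes, whereas it changes from \<open>1\<close> to \<open>(-1)^k\<close> on \<open>[0, \<pi>]\<close>.
  Conversely, for even \<open>k\<close> an orthogonal complex structure \<open>J\<close> gives the plane
  \<open>{(a, J a, s)}\<close>, over which the projection of \<open>F\<close> is essentially \<open>(exp (-s J) u, s)\<close>.\<close>

section \<open>Orthogonal projection onto a subspace\<close>

lemma orth_proj_eqI:
  assumes "subspace P" "y \<in> P" "\<And>z. z \<in> P \<Longrightarrow> orthogonal (x - y) z"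
  shows "orth_proj P x = y"
  unfolding orth_proj_def using orth_proj_ex1[OF assms(1), of x] assms by (intro the1_equality) auto

lemma
  assumes "subspace P"
  shows orth_proj_in: "orth_proj P x \<in> P"
    and orthogonal_diff_orth_proj: "z \<in> P \<Longrightarrow> orthogonal (x - orth_proj P x) z"
  using theI'[OF orth_proj_ex1[OF assms, of x]] by (simp_all add: orth_proj_def)

lemma linear_orth_proj:
  assumes "subspace P"
  shows "linear (orth_proj P)"
proof (rule linearI)
  fix x y
  show "orth_proj P (x + y) = orth_proj P x + orth_proj P y"
  proof (rule orth_proj_eqI[OF assms])
    show "orth_proj P x + orth_proj P y \<in> P"
      by (simp add: assms orth_proj_in subspace_add)
    show "orthogonal (x + y - (orth_proj P x + orth_proj P y)) z" if "z \<in> P" for z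
      using orthogonal_diff_orth_proj[OF assms that, of x] orthogonal_diff_orth_proj[OF assms that, of y]
      by (simp add: orthogonal_def inner_diff_left inner_add_left)
  qed
next
  fix r x
  show "orth_proj P (r *\<^sub>R x) = r *\<^sub>R orth_proj P x"
  proof (rule orth_proj_eqI[OF assms])
    show "r *\<^sub>R orth_proj P x \<in> P"
      by (simp add: assms orth_proj_in subspace_scale)
    show "orthogonal (r *\<^sub>R x - r *\<^sub>R orth_proj P x) z" if "z \<in> P" for z
      using orthogonal_diff_orth_proj[OF assms that, of x]
      by (simp add: orthogonal_def inner_diff_left)
  qed
qed

section \<open>Smoothness of maps built from cosine, sine and linear maps\<close>

text \<open>The terms are grouped by \<open>cos (\<tau> x)\<close> and \<open>sin (\<tau> x)\<close>
  so that, for fixed \<open>v\<close>, the derivative is again a map of the original shape in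
  \<open>x\<close>. The constants \<open>c1\<close>, \<open>c2\<close>, \<open>c3\<close> make room
  for terms such as \<open>L1 v\<close> that do not depend on \<open>x\<close>.\<close>

lemma has_derivative_cos_sin_linear:
  fixes L1 L2 L3 :: "'a::real_normed_vector \<Rightarrow> 'b::real_normed_vector"
  assumes [THEN bounded_linear.has_derivative, derivative_intros]:
    "bounded_linear \<tau>" "bounded_linear L1" "bounded_linear L2" "bounded_linear L3"
  shows "((\<lambda>x. cos (\<tau> x) *\<^sub>R (L1 x + c1) + sin (\<tau> x) *\<^sub>R (L2 x + c2) + (L3 x + c3)) has_derivative
      (\<lambda>v. cos (\<tau> x) *\<^sub>R (\<tau> v *\<^sub>R L2 x + (\<tau> v *\<^sub>R c2 + L1 v)) +
        sin (\<tau> x) *\<^sub>R (- \<tau> v *\<^sub>R L1 x + (- \<tau> v *\<^sub>R c1 + L2 v)) + L3 v)) (at x)"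
  by (auto intro!: derivative_eq_intros simp: algebra_simps fun_eq_iff)

text \<open>Directional derivatives stay in this class of functions, which gives the induction.\<close>

lemma Cn_on_cos_sin_linear:
  fixes L1 L2 L3 :: "'a::real_normed_vector \<Rightarrow> 'b::real_normed_vector"
  assumes "bounded_linear \<tau>" "bounded_linear L1" "bounded_linear L2" "bounded_linear L3"
  shows "Cn_on n (\<lambda>x. cos (\<tau> x) *\<^sub>R (L1 x + c1) + sin (\<tau> x) *\<^sub>R (L2 x + c2) + (L3 x + c3)) UNIV"
  using assms
proof (induction n arbitrary: L1 L2 L3 c1 c2 c3)
  case 0
  note D = has_derivative_cos_sin_linear[OF 0]
  show ?case
    unfolding Cn_on.simps
    by (intro continuous_at_imp_continuous_on ballI has_derivative_continuous[OF D])
next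
  case (Suc n)
  note D = has_derivative_cos_sin_linear[OF Suc.prems]
  \<comment> \<open>The \<open>0\<close> in \<open>0 + L3 v\<close> is the zero map in the role of
    the third linear part.\<close>
  have "Cn_on n (\<lambda>x. cos (\<tau> x) *\<^sub>R (\<tau> v *\<^sub>R L2 x + (\<tau> v *\<^sub>R c2 + L1 v)) +
      sin (\<tau> x) *\<^sub>R (- \<tau> v *\<^sub>R L1 x + (- \<tau> v *\<^sub>R c1 + L2 v)) + (0 + L3 v)) UNIV" for v
    by (intro Suc.IH Suc.prems bounded_linear_const_scaleR bounded_linear_zero)
  then show ?case
    unfolding Cn_on.simps frechet_derivative_at[OF D, symmetric] add_0_left
    using D by (fastforce simp: differentiable_def)
qed

lemma smooth_map_onI:
  assumes "\<And>n. Cn_on n g UNIV" "\<And>y. y \<in> A \<Longrightarrow> f y = g y"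
  shows "smooth_map_on A f"
  unfolding smooth_map_on_def using assms by (intro ballI exI[of _ UNIV] exI[of _ g]) auto

section \<open>Even dimension: a plane over which the helicoid is a graph\<close>

text \<open>Coordinates are numbered from 0 and paired as \<open>2j\<close>, \<open>2j + 1\<close>;
  on each pair \<open>J\<close> is a quarter turn. Evenness leaves no coordinate unpaired.\<close>

lemma even_card_obtains_complex_structure:
  assumes "even CARD('k::finite)"
  obtains J :: "real^'k \<Rightarrow> real^'k"
  where "linear J" "\<And>x. J (J x) = - x" "\<And>x y. J x \<bullet> y = - (x \<bullet> J y)"
proof -
  define m where "m = CARD('k)"
  obtain f :: "'k \<Rightarrow> nat" where f: "bij_betw f UNIV {0..<m}"
    using ex_bij_betw_finite_nat[of "UNIV::'k set"] by (auto simp: m_def)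
  define g where "g = inv_into UNIV f"
  have gf: "g (f i) = i" for i
    using f by (simp add: g_def bij_betw_def)
  have fg: "f (g n) = n" if "n < m" for n
    using f that by (simp add: g_def bij_betw_def f_inv_into_f)
  have lt: "f i < m" for i
    using f by (auto simp: bij_betw_def)
  define \<sigma> where "\<sigma> n = (if even n then n + 1 else n - 1)" for n :: nat
  have \<sigma>: "\<sigma> n < m" "\<sigma> (\<sigma> n) = n" "even (\<sigma> n) \<longleftrightarrow> odd n" if "n < m" for n
    using that assms by (auto simp: \<sigma>_def m_def elim!: evenE oddE)
  define \<tau> where "\<tau> i = g (\<sigma> (f i))" for i
  define \<epsilon> where "\<epsilon> i = (if even (f i) then 1 else - 1 :: real)" for i
  have \<tau>: "\<tau> (\<tau> i) = i" for i
    by (simp add: \<tau>_def fg \<sigma> lt gf)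
  have \<epsilon>: "\<epsilon> (\<tau> i) = - \<epsilon> i" "\<epsilon> i * \<epsilon> i = 1" for i
    by (simp_all add: \<tau>_def \<epsilon>_def fg \<sigma> lt)
  define J :: "real^'k \<Rightarrow> real^'k" where "J x = (\<chi> i. \<epsilon> i * x $ \<tau> i)" for x
  show thesis
  proof
    show "linear J"
      by (rule linearI) (auto simp: J_def vec_eq_iff algebra_simps)
    show "J (J x) = - x" for x
      by (simp add: J_def vec_eq_iff \<tau> \<epsilon> flip: mult.assoc)
    show "J x \<bullet> y = - (x \<bullet> J y)" for x y
    proof -
      have "J x \<bullet> y = (\<Sum>i\<in>UNIV. \<epsilon> i * x $ \<tau> i * y $ i)"
        by (simp add: J_def inner_vec_def)
      \<comment> \<open>Reindexing by the involution \<open>\<tau>\<close> moves it from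
        \<open>x\<close> to \<open>y\<close>; the sign change of \<open>\<epsilon>\<close> under
        \<open>\<tau>\<close> then yields the minus.\<close>
      also have "\<dots> = (\<Sum>i\<in>UNIV. \<epsilon> (\<tau> i) * x $ i * y $ \<tau> i)"
        by (rule sum.reindex_bij_witness[of _ \<tau> \<tau>]) (auto simp: \<tau>)
      also have "\<dots> = - (x \<bullet> J y)"
        by (simp add: J_def inner_vec_def \<epsilon> sum_negf algebra_simps)
      finally show ?thesis .
    qed
  qed
qed

lemma entire_graph_if_even:
  assumes "even CARD('k::finite)"
  shows "entire_graph_over_plane
    (helicoid_param :: (real^'k) \<times> real \<Rightarrow> (real^'k) \<times> (real^'k) \<times> real) (CARD('k) + 1)"
proof -
  obtain J :: "real^'k \<Rightarrow> real^'k" where J: "linear J" "\<And>x. J (J x) = - x"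
    and skew: "\<And>x y. J x \<bullet> y = - (x \<bullet> J y)"
    using even_card_obtains_complex_structure[OF assms] by blast
  have J_simps: "J (x + y) = J x + J y" "J (x - y) = J x - J y" "J (r *\<^sub>R x) = r *\<^sub>R J x" for x y r
    using J(1) by (simp_all add: linear_add linear_diff linear_scale)
  have [bounded_linear]: "bounded_linear J"
    using J(1) by (simp add: linear_conv_bounded_linear)
  define \<iota> where "\<iota> = (\<lambda>(a, s). (a, J a, s) :: (real^'k) \<times> (real^'k) \<times> real)"
  define P where "P = range \<iota>"
  have "linear \<iota>"
    by (rule linearI) (auto simp: \<iota>_def J_simps)
  have P: "subspace P"
    unfolding P_def using \<open>linear \<iota>\<close> by (intro linear_subspace_image) auto
  have "inj \<iota>"
    by (auto simp: inj_def \<iota>_def)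
  then have dim: "dim P = CARD('k) + 1"
    unfolding P_def using dim_image_eq[OF \<open>linear \<iota>\<close>, of UNIV] by simp
  define F where "F = orth_proj P \<circ> (helicoid_param :: (real^'k) \<times> real \<Rightarrow> _)"
  \<comment> \<open>In general \<open>(a, b, s)\<close> projects to
    \<open>((a - J b) / 2, (b + J a) / 2, s)\<close>; the factor 1/2 appears because
    \<open>(a, J a)\<close> has twice the squared norm of \<open>a\<close>.\<close>
  have F: "F (u, s) = (1/2) *\<^sub>R (cos s *\<^sub>R (u, J u, 0) + sin s *\<^sub>R (- J u, u, 0)) + (0, 0, s)" for u s
    unfolding F_def comp_def helicoid_param_def prod.case
  proof (rule orth_proj_eqI[OF P])
    show "(1/2) *\<^sub>R (cos s *\<^sub>R (u, J u, 0) + sin s *\<^sub>R (- J u, u, 0)) + (0, 0, s) \<in> P"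
      unfolding P_def \<iota>_def
      by (rule image_eqI[of _ _ "((1/2) *\<^sub>R (cos s *\<^sub>R u - sin s *\<^sub>R J u), s)"])
        (auto simp: J_simps J(2))
    show "orthogonal ((cos s *\<^sub>R u, sin s *\<^sub>R u, s) -
        ((1/2) *\<^sub>R (cos s *\<^sub>R (u, J u, 0) + sin s *\<^sub>R (- J u, u, 0)) + (0, 0, s))) z" if z: "z \<in> P" for z
    proof -
      obtain a t where z: "z = (a, J a, t)"
        using z by (auto simp: P_def \<iota>_def)
      have "u \<bullet> J a = - (J u \<bullet> a)" "J u \<bullet> J a = u \<bullet> a"
        using skew[of u a] skew[of u "J a"] by (simp_all add: J(2))
      then show ?thesis
        unfolding z by (simp add: orthogonal_def algebra_simps inner_diff_left inner_add_left)
    qed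
  qed
  \<comment> \<open>The first component of \<open>F (u, s)\<close> is half of
    \<open>exp (-s J) u\<close>, so \<open>2 exp (s J)\<close> recovers \<open>u\<close>. The
    formula makes sense off \<open>P\<close> too and thus extends the inverse smoothly to the
    ambient space.\<close>
  define G where "G = (\<lambda>(a :: real^'k, b :: real^'k, s). (2 *\<^sub>R (cos s *\<^sub>R a + sin s *\<^sub>R J a), s))"
  have sq: "cos s *\<^sub>R cos s *\<^sub>R u + sin s *\<^sub>R sin s *\<^sub>R u = u" for s and u :: "real^'k"
    using sin_cos_squared_add3[of s] by (simp flip: scaleR_left_distrib)
  have GF: "G (F (u, s)) = (u, s)" for u s
    unfolding F G_def using sq[of s u]
    by (simp add: J_simps J(2) linear_neg[OF J(1)] algebra_simps)
  have FG: "F (G y) = y" if y: "y \<in> P" for y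
  proof -
    obtain a s where y: "y = (a, J a, s)"
      using y by (auto simp: P_def \<iota>_def)
    show ?thesis
      unfolding y F G_def prod.case using sq[of s a] sq[of s "J a"]
      by (simp add: J_simps J(2) linear_neg[OF J(1)] algebra_simps)
  qed
  have F_in: "F x \<in> P" for x
    by (simp add: F_def orth_proj_in[OF P])
  have bij: "bij_betw F UNIV P"
    using GF FG F_in by (intro bij_betwI[of _ _ _ G]) auto
  have inv: "inv_into UNIV F y = G y" if "y \<in> P" for y
    using bij that FG by (metis UNIV_I bij_betw_imp_inj_on inv_into_f_f)
  have smF: "smooth_map_on UNIV F"
  proof (rule smooth_map_onI)
    fix n
    show "Cn_on n (\<lambda>x :: (real^'k) \<times> real. cos (snd x) *\<^sub>R ((1/2) *\<^sub>R (fst x, J (fst x), 0) + 0) +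
        sin (snd x) *\<^sub>R ((1/2) *\<^sub>R (- J (fst x), fst x, 0) + 0) + ((0, 0, snd x) + 0)) UNIV"
      by (intro Cn_on_cos_sin_linear bounded_linear_intros bounded_linear_Pair bounded_linear_minus)
  qed (auto simp: F algebra_simps)
  have smG: "smooth_map_on P (inv_into UNIV F)"
  proof (rule smooth_map_onI)
    fix n
    show "Cn_on n (\<lambda>x :: (real^'k) \<times> (real^'k) \<times> real. cos (snd (snd x)) *\<^sub>R ((2 *\<^sub>R fst x, 0) + 0) +
        sin (snd (snd x)) *\<^sub>R ((2 *\<^sub>R J (fst x), 0) + 0) + ((0, snd (snd x)) + 0)) UNIV"
      by (intro Cn_on_cos_sin_linear bounded_linear_intros bounded_linear_Pair)
  qed (auto simp: inv G_def algebra_simps)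
  show ?thesis
    unfolding entire_graph_over_plane_def diffeomorphism_between_def
    using P dim bij smF smG by (auto simp: F_def)
qed

section \<open>Necessity of even dimension\<close>

text \<open>The path joins the identity to its negative, whose determinant is -1 in odd dimension,
  so the intermediate value theorem would give a zero.\<close>

lemma even_card_if_det_nonzero:
  fixes T :: "real^'k^'k"
  assumes "\<And>s. det (cos s *\<^sub>R mat 1 + sin s *\<^sub>R T) \<noteq> 0"
  shows "even CARD('k)"
proof (rule ccontr)
  assume odd: "odd CARD('k)"
  let ?f = "\<lambda>s. det (cos s *\<^sub>R mat 1 + sin s *\<^sub>R T)"
  have "continuous_on {0..pi} ?f"
    unfolding det_def by (intro continuous_intros)
  moreover have "0 \<le> ?f 0"
    by simp
  moreover have "?f pi \<le> 0"
  proof -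
    have "?f pi = (\<Prod>i\<in>(UNIV :: 'k set). - 1 :: real)"
      by (subst det_diagonal) (auto simp: mat_def)
    also have "\<dots> \<le> 0"
      using odd by simp
    finally show ?thesis .
  qed
  ultimately obtain s where "?f s = 0"
    by (meson IVT2' pi_ge_zero)
  then show False
    using assms by blast
qed

text \<open>The smooth extension of the inverse is defined on an ambient neighbourhood only; composing it
  with \<open>f\<close>, whose values lie in \<open>B\<close>, still gives the identity.\<close>

lemma diffeomorphism_between_inj_derivative:
  assumes diff: "diffeomorphism_between UNIV B f" and f': "(f has_derivative f') (at x)"
  shows "inj f'"
proof -
  have f_B: "f y \<in> B" and inv_f: "inv f (f y) = y" for y
    using diff by (auto simp: diffeomorphism_between_def bij_betw_def)
  have "smooth_map_on B (inv f)"
    using diff by (simp add: diffeomorphism_between_def)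
  then obtain U g where U: "open U" "f x \<in> U" "\<forall>n. Cn_on n g U" "\<forall>y\<in>B \<inter> U. g y = inv f y"
    using f_B[of x] unfolding smooth_map_on_def by blast
  from U(3) have "Cn_on (Suc 0) g U" ..
  then obtain g' where g': "(g has_derivative g') (at (f x))"
    using U(2) unfolding Cn_on.simps differentiable_def by blast
  \<comment> \<open>On such a \<open>V\<close> the composition \<open>g \<circ> f\<close> is the
    identity.\<close>
  have "\<exists>V. open V \<and> x \<in> V \<and> (\<forall>y\<in>V. f y \<in> U)"
    using has_derivative_continuous[OF f'] U(1,2) by (simp only: continuous_at_open)
  then obtain V where V: "open V" "x \<in> V" "\<forall>y\<in>V. f y \<in> U"
    by (elim exE conjE)
  have "((g \<circ> f) has_derivative (g' \<circ> f')) (at x)"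
    using diff_chain_at[OF f' g'] .
  then have "((\<lambda>y. y) has_derivative (g' \<circ> f')) (at x)"
    by (rule has_derivative_transform_within_open[OF _ V(1,2)]) (simp add: V(3) U(4) f_B inv_f)
  \<comment> \<open>Thus \<open>g'\<close> is a left inverse of \<open>f'\<close>.\<close>
  then have "g' \<circ> f' = (\<lambda>y. y)"
    by (rule has_derivative_unique) (rule has_derivative_ident)
  then show "inj f'"
    by (intro inj_on_inverseI[of _ g']) (simp add: fun_eq_iff)
qed

lemma even_card_if_entire_graph:
  assumes "entire_graph_over_plane
    (helicoid_param :: (real^'k::finite) \<times> real \<Rightarrow> (real^'k) \<times> (real^'k) \<times> real) (CARD('k) + 1)"
  shows "even CARD('k)"
proof -
  define h where "h = (helicoid_param :: (real^'k) \<times> real \<Rightarrow> (real^'k) \<times> (real^'k) \<times> real)"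
  obtain P where P: "subspace P" "dim P = CARD('k) + 1"
    and diff: "diffeomorphism_between UNIV P (orth_proj P \<circ> h)"
    using assms by (auto simp: entire_graph_over_plane_def h_def)
  note lin = linear_orth_proj[OF P(1)]
  have [bounded_linear]: "bounded_linear (orth_proj P)"
    using lin by (simp add: linear_conv_bounded_linear)
  define A where "A u = orth_proj P (u, 0, 0)" for u :: "real^'k"
  define B where "B u = orth_proj P (0, u, 0)" for u :: "real^'k"
  define c where "c = orth_proj P (0, 0, 1 :: real)"
  have [bounded_linear]: "bounded_linear A" "bounded_linear B"
    unfolding A_def B_def by (intro bounded_linear_intros bounded_linear_Pair)+
  then have linA: "linear A" and linB: "linear B"
    by (simp_all add: linear_conv_bounded_linear)
  have AB_in: "A u \<in> P" "B u \<in> P" "c \<in> P" for u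
    by (simp_all add: A_def B_def c_def orth_proj_in[OF P(1)])
  define F where "F = orth_proj P \<circ> h"
  have F: "F (u, s) = cos s *\<^sub>R A u + sin s *\<^sub>R B u + s *\<^sub>R c" for u s
    by (simp add: F_def h_def helicoid_param_def A_def B_def c_def
        flip: linear_scale[OF lin] linear_add[OF lin])
  have "inj F"
    using diff by (simp add: F_def diffeomorphism_between_def bij_betw_def)
  have inj0: "u = 0" if "cos s *\<^sub>R A u + sin s *\<^sub>R B u = 0" for u s
  proof -
    have "F (u, s) = F (0, s)"
      using that by (simp add: F linear_0 linA linB)
    then show ?thesis
      using \<open>inj F\<close> by (simp add: inj_eq)
  qed
  have "inj A"
    using inj0[of 0] by (simp add: linear_injective_0[OF linA])
  have F': "(F has_derivative (\<lambda>(v, t). A v + t *\<^sub>R (B u + c))) (at (u, 0))" for u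
  proof -
    have "F = (\<lambda>x. cos (snd x) *\<^sub>R (A (fst x) + 0) + sin (snd x) *\<^sub>R (B (fst x) + 0) +
        (snd x *\<^sub>R c + 0))"
      by (auto simp: F)
    then show ?thesis
      by (simp only:)
        (rule has_derivative_eq_rhs[OF has_derivative_cos_sin_linear],
          (intro bounded_linear_intros)+, auto simp: algebra_simps)
  qed
  have "B u \<in> range A" for u
  proof (rule ccontr)
    assume Bu: "B u \<notin> range A"
    have sub: "subspace (range A)"
      using linA by (intro linear_subspace_image) auto
    then have span: "span (range A) = range A"
      by (simp add: span_eq_iff)
    \<comment> \<open>Injectivity of \<open>A\<close> makes \<open>range A\<close> a hyperplane of
      \<open>P\<close>, so one vector outside it completes the span.\<close>
    have span_P: "span (insert (B u) (range A)) = P"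
    proof (rule subspace_dim_equal)
      show "span (insert (B u) (range A)) \<subseteq> P"
        using AB_in P(1) by (intro span_minimal) auto
      have "dim (insert (B u) (range A)) = CARD('k) + 1"
        using Bu dim_image_eq[OF linA, of UNIV] \<open>inj A\<close> unfolding dim_insert span by simp
      then show "dim P \<le> dim (span (insert (B u) (range A)))"
        using P(2) by simp
    qed (use P in auto)
    obtain r where "c - r *\<^sub>R B u \<in> range A"
      using AB_in(3)[folded span_P] span_breakdown_eq[of c "B u" "range A", unfolded span] by auto
    then obtain w where w: "c = r *\<^sub>R B u + A w"
      by (auto simp: algebra_simps)
    \<comment> \<open>This is the derivative at \<open>(- r u, 0)\<close>. The multiple
      \<open>- r\<close> cancels the part of \<open>c\<close> along \<open>B u\<close>, leaving
      \<open>A (v + t w)\<close>, which kills \<open>(- w, 1)\<close>.\<close>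
    define F' where "F' = (\<lambda>(v, t). A v + t *\<^sub>R (B (- r *\<^sub>R u) + c))"
    have "inj F'"
      unfolding F'_def
      by (rule diffeomorphism_between_inj_derivative[OF diff[folded F_def] F'])
    moreover have "F' (- w, 1) = F' (0, 0)"
      by (simp add: F'_def w linear_neg linear_0 linear_scale linA linB)
    ultimately show False
      by (simp add: inj_eq)
  qed
  moreover obtain A' where A': "linear A'" "A' \<circ> A = id"
    using linear_injective_left_inverse[OF linA \<open>inj A\<close>] by blast
  \<comment> \<open>With \<open>T = A' \<circ> B\<close> this says \<open>B = A T\<close>: on
    \<open>range A\<close> the left inverse \<open>A'\<close> is also a right inverse.\<close>
  ultimately have AT: "A (A' (B u)) = B u" for u
    by (metis comp_apply id_apply imageE)
  have linT: "linear (A' \<circ> B)"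
    using linB A'(1) by (rule linear_compose)
  show ?thesis
  proof (rule even_card_if_det_nonzero)
    fix s
    let ?M = "cos s *\<^sub>R mat 1 + sin s *\<^sub>R matrix (A' \<circ> B)"
    \<comment> \<open>Applying \<open>A\<close> to \<open>?M *v u = 0\<close> turns it into the
      equation handled by \<open>inj0\<close>.\<close>
    have "u = 0" if "?M *v u = 0" for u
    proof (rule inj0)
      have "?M *v u = cos s *\<^sub>R u + sin s *\<^sub>R A' (B u)"
        using fun_cong[OF matrix_vector_mul(1)[of "A' \<circ> B"], of u]
        by (simp add: linT linear_matrix_vector_mul_eq matrix_vector_mult_add_rdistrib scaleR_matrix_vector_assoc[symmetric])
      then have "A (cos s *\<^sub>R u + sin s *\<^sub>R A' (B u)) = 0"
        using that by (simp add: linear_0 linA)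
      then show "cos s *\<^sub>R A u + sin s *\<^sub>R B u = 0"
        by (simp add: linear_add linear_scale linA AT)
    qed
    then have "invertible ?M"
      using matrix_left_invertible_ker invertible_left_inverse by blast
    then show "det ?M \<noteq> 0"
      by (simp add: invertible_det_nz)
  qed
qed

theorem corollary8p2:
  shows "entire_graph_over_plane
           (helicoid_param :: (real^'k) \<times> real \<Rightarrow> (real^'k) \<times> (real^'k) \<times> real)
           (CARD('k) + 1)
         \<longleftrightarrow> even (CARD('k))"
  using entire_graph_if_even even_card_if_entire_graph by blast

end
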